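(* Let $A\in\mathbb{R}^{m\times n}$. (a) If $A(\mathbb{R}^n)+\mathbb{R}^m_+=\mathbb{R}^m$ then $$H(A)=\frac{1}{\displaystyle\min_{v\in\mathbb{R}^m_+,\ \|v\|^*=1}\|A^{\mathsf T}v\|^*}.$$ (b) Suppose $\mathcal{F}\subseteq\mathcal{S}(A)$ and $\mathcal{I}\subseteq 2^{[m]}\setminus\mathcal{S}(A)$ are such that for all $J\subseteq[m]$ either $J\subseteq F$ for some $F\in\mathcal{F}$, or $I\subseteq J$ for some $I\in\mathcal{I}$. Then $$H(A)=\max_{J\in\mathcal{F}}H_J(A)=\max_{J\in\mathcal{F}}\frac{1}{\displaystyle\min_{v\in\mathbb{R}^J_+,\ \|v\|^*=1}\|A_J^{\mathsf T}v\|^*}.$$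
   Context: $\mathbb{R}^n$ and $\mathbb{R}^m$ are each endowed with an arbitrary norm (not necessarily Euclidean), both denoted $\|\cdot\|$, and with the standard inner product $\langle\cdot,\cdot\rangle$. The dual norm is $\|u\|^*:=\max_{\|x\|\le1}\langle u,x\rangle$. $[m]=\{1,\dots,m\}$. For $J\subseteq[m]$, $A_J$ is the submatrix of $A$ of rows indexed by $J$, $y_J$ the corresponding subvector of $y\in\mathbb{R}^m$. For $v\in\mathbb{R}^J_+$, $\|v\|^*$ is the dual norm in $\mathbb{R}^m$ of $v$ extended by zeros outside $J$. A minimum over an empty set (e.g. when $J=\emptyset$) is $+\infty$, and its reciprocal is $0$. Define $\mathcal{S}(A):=\{J\subseteq[m]: A_J(\mathbb{R}^n)+\mathbb{R}^J_+=\mathbb{R}^J\}$ (with $\emptyset\in\mathcal S(A)$), where $A_J(\mathbb{R}^n)=\{A_Jx:x\in\mathbb{R}^n\}$; for $J\in\mathcal{S}(A)$ $$H_J(A):=\max_{y\in\mathbb{R}^m,\ \|y\|\le 1}\ \min_{x\in\mathbb{R}^n,\ A_Jx\le y_J}\|x\|,$$ with $H_J(A):=0$ if $J=\emptyset$; and $H(A):=\max_{J\in\mathcal{S}(A)}H_J(A)$. *)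

theory Defs
  imports "HOL-Analysis.Analysis"
begin

text \<open>
  The norms are arbitrary, hence not the class operation \<^const>\<open>norm\<close> (which is Euclidean on
  \<^typ>\<open>real ^ 'n\<close>); the inner product \<^const>\<open>inner\<close> is the standard one.
\<close>

definition is_norm :: "('a::real_vector \<Rightarrow> real) \<Rightarrow> bool" where
  "is_norm N \<longleftrightarrow>
     (\<forall>x. N x = 0 \<longleftrightarrow> x = 0) \<and>
     (\<forall>x y. N (x + y) \<le> N x + N y) \<and>
     (\<forall>c x. N (c *\<^sub>R x) = \<bar>c\<bar> * N x)"

text \<open>
  Maxima and minima over infinite sets are written as suprema and infima. For \<open>J\<close> in
  \<open>surjective_sets A\<close> below they are attained, except where the set is empty; see the lemmas
  ending in \<open>_attained\<close>.
\<close>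

definition dual_norm :: "('a::real_inner \<Rightarrow> real) \<Rightarrow> 'a \<Rightarrow> real" where
  "dual_norm N u = (SUP x\<in>{x. N x \<le> 1}. u \<bullet> x)"

text \<open>
  For a set \<open>J\<close> of row indices, a vector indexed by \<open>J\<close> is represented by its extension by zeros
  outside \<open>J\<close>, and the submatrix of the rows in \<open>J\<close> by zeroing the other rows.
\<close>

definition coord_space :: "'m set \<Rightarrow> (real ^ 'm::finite) set" where
  "coord_space J = {v. \<forall>i. i \<notin> J \<longrightarrow> v $ i = 0}"

definition nonneg_orthant :: "'m set \<Rightarrow> (real ^ 'm::finite) set" where
  "nonneg_orthant J = {v \<in> coord_space J. \<forall>i\<in>J. 0 \<le> v $ i}"

definition submatrix_rows :: "real ^ 'n ^ 'm \<Rightarrow> 'm set \<Rightarrow> real ^ 'n ^ 'm" where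
  "submatrix_rows A J = (\<chi> i. if i \<in> J then A $ i else 0)"

definition surjective_sets :: "real ^ 'n ^ 'm \<Rightarrow> 'm::finite set set" where
  "surjective_sets A =
     {J. range ((*v) (submatrix_rows A J)) + nonneg_orthant J = coord_space J}"

text \<open>
  The values lie in \<^typ>\<open>ereal\<close>, where an infimum over the empty set is \<open>\<infinity>\<close> and \<open>1 / \<infinity> = 0\<close>.
\<close>

definition hoffman_on ::
    "(real ^ 'n \<Rightarrow> real) \<Rightarrow> (real ^ 'm \<Rightarrow> real) \<Rightarrow> real ^ 'n ^ 'm \<Rightarrow> 'm::finite set \<Rightarrow> ereal" where
  "hoffman_on N M A J =
     (if J = {} then 0
      else SUP y\<in>{y. M y \<le> 1}.
             INF x\<in>{x. \<forall>i\<in>J. (submatrix_rows A J *v x) $ i \<le> y $ i}. ereal (N x))"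

definition hoffman ::
    "(real ^ 'n \<Rightarrow> real) \<Rightarrow> (real ^ 'm \<Rightarrow> real) \<Rightarrow> real ^ 'n ^ 'm::finite \<Rightarrow> ereal" where
  "hoffman N M A = Max (hoffman_on N M A ` surjective_sets A)"


lemma is_norm_zero: "is_norm N \<Longrightarrow> N 0 = 0"
  unfolding is_norm_def by blast

lemma is_norm_nonneg:
  assumes "is_norm N" shows "0 \<le> N x"
proof -
  have "N (x + (-1) *\<^sub>R x) \<le> N x + N ((-1) *\<^sub>R x)"
    using assms unfolding is_norm_def by blast
  moreover have "N ((-1) *\<^sub>R x) = N x"
    using assms unfolding is_norm_def by (metis abs_minus_cancel abs_one mult_1)
  moreover have "N (x + (-1) *\<^sub>R x) = 0"
    using assms unfolding is_norm_def by simp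
  ultimately show ?thesis by linarith
qed

lemma is_norm_convex:
  assumes "is_norm N" shows "convex_on UNIV N"
proof (rule convex_onI)
  fix t x y assume "0 < (t::real)" "t < 1"
  have "N ((1 - t) *\<^sub>R x + t *\<^sub>R y) \<le> N ((1 - t) *\<^sub>R x) + N (t *\<^sub>R y)"
    using assms unfolding is_norm_def by blast
  also have "\<dots> = (1 - t) * N x + t * N y"
    using assms \<open>0 < t\<close> \<open>t < 1\<close> unfolding is_norm_def by simp
  finally show "N ((1 - t) *\<^sub>R x + t *\<^sub>R y) \<le> (1 - t) * N x + t * N y" .
qed simp

lemma is_norm_continuous:
  fixes N :: "'a::euclidean_space \<Rightarrow> real"
  assumes "is_norm N" shows "continuous_on UNIV N"
  using is_norm_convex[OF assms] by (rule convex_on_continuous[OF open_UNIV])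

lemma is_norm_compact:
  fixes N :: "'a::euclidean_space \<Rightarrow> real"
  assumes N: "is_norm N" shows "compact {x. N x \<le> r}"
proof -
  have cl: "closed {x. N x \<le> r}"
    using is_norm_continuous[OF N] by (intro closed_Collect_le) auto
  obtain b :: 'a where "b \<in> Basis" using nonempty_Basis by blast
  then have ne: "sphere (0::'a) 1 \<noteq> {}" by (force simp: norm_Basis)
  have "continuous_on (sphere (0::'a) 1) N"
    using is_norm_continuous[OF N] continuous_on_subset by blast
  then obtain z where z: "z \<in> sphere 0 1" "\<forall>y\<in>sphere 0 1. N z \<le> N y"
    using continuous_attains_inf[OF compact_sphere ne] by blast
  have "N z \<noteq> 0" using z(1) N unfolding is_norm_def by auto
  then have pos: "0 < N z" using is_norm_nonneg[OF N, of z] by linarith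
  have "N z * norm x \<le> N x" for x
  proof (cases "x = 0")
    case False
    have "N z \<le> N ((1 / norm x) *\<^sub>R x)" using z(2) False by simp
    also have "\<dots> = N x / norm x" using N unfolding is_norm_def by simp
    finally show ?thesis using False by (simp add: field_simps)
  qed (use is_norm_nonneg[OF N] in simp)
  then have "norm x \<le> r / N z" if "N x \<le> r" for x
    using pos that by (simp add: field_simps) (meson order_trans)
  then have "bounded {x. N x \<le> r}" by (auto simp: bounded_iff)
  with cl show ?thesis by (simp add: compact_eq_bounded_closed)
qed

lemma dual_norm_attained:
  fixes N :: "'a::euclidean_space \<Rightarrow> real"
  assumes N: "is_norm N"
  shows "\<exists>x. N x \<le> 1 \<and> dual_norm N u = u \<bullet> x \<and> (\<forall>y. N y \<le> 1 \<longrightarrow> u \<bullet> y \<le> u \<bullet> x)"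
proof -
  have "N 0 \<le> 1" using is_norm_zero[OF N] by simp
  then have ne: "{x. N x \<le> 1} \<noteq> {}" by blast
  have "continuous_on {x. N x \<le> 1} (\<lambda>x. u \<bullet> x)" by (intro continuous_intros)
  from continuous_attains_sup[OF is_norm_compact[OF N] ne this]
  obtain x where x: "N x \<le> 1" "\<forall>y. N y \<le> 1 \<longrightarrow> u \<bullet> y \<le> u \<bullet> x" by blast
  have "dual_norm N u = u \<bullet> x"
    unfolding dual_norm_def using x by (intro cSup_eq_maximum) auto
  with x show ?thesis by blast
qed

lemma dual_norm_upper:
  fixes N :: "'a::euclidean_space \<Rightarrow> real"
  assumes "is_norm N" "N y \<le> 1"
  shows "u \<bullet> y \<le> dual_norm N u"
  using dual_norm_attained[OF assms(1), of u] assms(2) by auto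

lemma is_norm_dual_norm:
  fixes N :: "'a::euclidean_space \<Rightarrow> real"
  assumes N: "is_norm N"
  shows "is_norm (dual_norm N)"
proof -
  have N0: "N 0 = 0" and hom: "\<And>c x. N (c *\<^sub>R x) = \<bar>c\<bar> * N x"
    and Nz: "\<And>x. N x = 0 \<Longrightarrow> x = 0"
    using N unfolding is_norm_def by auto
  have zero: "dual_norm N 0 = 0" using dual_norm_attained[OF N, of 0] by auto
  have pos: "0 < dual_norm N u" if "u \<noteq> 0" for u
  proof -
    have "0 < N u" using that Nz is_norm_nonneg[OF N, of u] by (metis order_less_le)
    then have "N ((1 / N u) *\<^sub>R u) \<le> 1" by (simp add: hom)
    from dual_norm_upper[OF N this, of u] have "(u \<bullet> u) / N u \<le> dual_norm N u" by simp
    moreover have "0 < (u \<bullet> u) / N u" using that \<open>0 < N u\<close> by simp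
    ultimately show ?thesis by linarith
  qed
  have tri: "dual_norm N (u + v) \<le> dual_norm N u + dual_norm N v" for u v
    using dual_norm_attained[OF N, of "u + v"] dual_norm_upper[OF N]
    by (metis add_mono inner_add_left)
  have le: "dual_norm N (c *\<^sub>R u) \<le> \<bar>c\<bar> * dual_norm N u" for c u
  proof -
    obtain x where x: "N x \<le> 1" "dual_norm N (c *\<^sub>R u) = (c *\<^sub>R u) \<bullet> x"
      using dual_norm_attained[OF N, of "c *\<^sub>R u"] by blast
    have "N (sgn c *\<^sub>R x) \<le> 1"
      using x(1) is_norm_nonneg[OF N, of x] by (auto simp: hom abs_sgn_eq)
    then have "sgn c * (u \<bullet> x) \<le> dual_norm N u"
      using dual_norm_upper[OF N, of "sgn c *\<^sub>R x" u] by simp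
    then have "\<bar>c\<bar> * (sgn c * (u \<bullet> x)) \<le> \<bar>c\<bar> * dual_norm N u"
      by (intro mult_left_mono) auto
    moreover have "\<bar>c\<bar> * (sgn c * (u \<bullet> x)) = c * (u \<bullet> x)"
      by (metis abs_mult_sgn mult.assoc)
    ultimately show ?thesis using x(2) by simp
  qed
  have eq: "dual_norm N (c *\<^sub>R u) = \<bar>c\<bar> * dual_norm N u" for c u
  proof (cases "c = 0")
    case False
    have "dual_norm N ((1 / c) *\<^sub>R (c *\<^sub>R u)) \<le> \<bar>1 / c\<bar> * dual_norm N (c *\<^sub>R u)" by (rule le)
    then have "\<bar>c\<bar> * dual_norm N u \<le> dual_norm N (c *\<^sub>R u)" using False by (simp add: field_simps)
    with le[of c u] show ?thesis by linarith
  qed (simp add: zero)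
  show ?thesis unfolding is_norm_def using zero pos tri eq by (metis order_less_irrefl)
qed

lemma hoffman_on_inner_min_attained:
  fixes A :: "real ^ 'n ^ 'm::finite"
  assumes N: "is_norm N" and J: "J \<in> surjective_sets A"
  defines "S \<equiv> \<lambda>y. {x. \<forall>i\<in>J. (submatrix_rows A J *v x) $ i \<le> y $ i}"
  shows "\<exists>x\<in>S y. (INF x\<in>S y. ereal (N x)) = ereal (N x) \<and> (\<forall>x'\<in>S y. N x \<le> N x')"
proof -
  let ?B = "submatrix_rows A J"
  have "(\<chi> i. if i \<in> J then y $ i else 0) \<in> coord_space J" by (simp add: coord_space_def)
  then have "(\<chi> i. if i \<in> J then y $ i else 0) \<in> range ((*v) ?B) + nonneg_orthant J"
    using J by (simp add: surjective_sets_def)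
  then obtain x0 s where x0: "(\<chi> i. if i \<in> J then y $ i else 0) = ?B *v x0 + s"
    and s: "s \<in> nonneg_orthant J" by (auto elim!: set_plus_elim)
  have "(?B *v x0) $ i \<le> y $ i" if "i \<in> J" for i
    using arg_cong[OF x0, of "\<lambda>v. v $ i"] s that by (auto simp: nonneg_orthant_def)
  then have x0S: "x0 \<in> S y" by (simp add: S_def)
  have "continuous_on UNIV (\<lambda>x. (?B *v x) $ i)" for i
    by (rule continuous_on_component[OF matrix_vector_mult_linear_continuous_on])
  then have "closed {x. (?B *v x) $ i \<le> y $ i}" for i
    by (rule closed_Collect_le) (rule continuous_on_const)
  then have "closed (\<Inter>i\<in>J. {x. (?B *v x) $ i \<le> y $ i})" by blast
  moreover have "S y = (\<Inter>i\<in>J. {x. (?B *v x) $ i \<le> y $ i})" by (auto simp: S_def)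
  ultimately have "closed (S y)" by simp
  then have cp: "compact ({x. N x \<le> N x0} \<inter> S y)"
    using is_norm_compact[OF N] by (rule compact_Int_closed[rotated])
  have ne: "{x. N x \<le> N x0} \<inter> S y \<noteq> {}" using x0S by blast
  have "continuous_on ({x. N x \<le> N x0} \<inter> S y) N"
    using is_norm_continuous[OF N] by (rule continuous_on_subset) simp
  then obtain x where x: "x \<in> {x. N x \<le> N x0} \<inter> S y"
    "\<forall>x'\<in>{x. N x \<le> N x0} \<inter> S y. N x \<le> N x'"
    using continuous_attains_inf[OF cp ne] by blast
  have min: "\<forall>x'\<in>S y. N x \<le> N x'"
    using x by (metis (mono_tags, lifting) IntD1 IntI linear mem_Collect_eq order_trans)
  have "(INF x\<in>S y. ereal (N x)) = ereal (N x)"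
    using x(1) min by (intro antisym INF_lower INF_greatest) auto
  then show ?thesis using x(1) min by blast
qed

lemma hoffman_on_outer_max_attained:
  fixes A :: "real ^ 'n ^ 'm::finite"
  assumes N: "is_norm N" and M: "is_norm M" and J: "J \<in> surjective_sets A" and "J \<noteq> {}"
  shows "\<exists>y. M y \<le> 1 \<and> hoffman_on N M A J =
           (INF x\<in>{x. \<forall>i\<in>J. (submatrix_rows A J *v x) $ i \<le> y $ i}. ereal (N x))"
proof -
  let ?B = "submatrix_rows A J"
  define S where "S = (\<lambda>y::real^'m. {x. \<forall>i\<in>J. (?B *v x) $ i \<le> y $ i})"
  have "\<forall>y. \<exists>x. x \<in> S y \<and> (INF x\<in>S y. ereal (N x)) = ereal (N x) \<and> (\<forall>x'\<in>S y. N x \<le> N x')"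
    using hoffman_on_inner_min_attained[OF N J] unfolding S_def by blast
  then obtain X where X: "\<And>y. X y \<in> S y" "\<And>y. (INF x\<in>S y. ereal (N x)) = ereal (N (X y))"
    "\<And>y x'. x' \<in> S y \<Longrightarrow> N (X y) \<le> N x'" by metis
  have "convex_on UNIV (\<lambda>y. N (X y))"
  proof (rule convex_onI)
    fix t :: real and y z :: "real^'m" assume t: "0 < t" "t < 1"
    let ?x = "(1 - t) *\<^sub>R X y + t *\<^sub>R X z"
    have "?x \<in> S ((1 - t) *\<^sub>R y + t *\<^sub>R z)"
      using X(1)[of y] X(1)[of z] t
      by (auto simp: S_def matrix_vector_right_distrib matrix_vector_mult_scaleR
          intro!: add_mono mult_left_mono)
    then have "N (X ((1 - t) *\<^sub>R y + t *\<^sub>R z)) \<le> N ?x" by (rule X(3))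
    also have "\<dots> \<le> (1 - t) * N (X y) + t * N (X z)"
      using convex_onD[OF is_norm_convex[OF N], of t "X y" "X z"] t by simp
    finally show "N (X ((1 - t) *\<^sub>R y + t *\<^sub>R z)) \<le> (1 - t) * N (X y) + t * N (X z)" .
  qed simp
  then have "continuous_on UNIV (\<lambda>y. N (X y))" by (rule convex_on_continuous[OF open_UNIV])
  then have cont: "continuous_on {y. M y \<le> 1} (\<lambda>y. N (X y))" by (rule continuous_on_subset) simp
  have "M 0 \<le> 1" using is_norm_zero[OF M] by simp
  then have "{y. M y \<le> 1} \<noteq> {}" by blast
  then obtain y where y: "M y \<le> 1" "\<And>z. M z \<le> 1 \<Longrightarrow> N (X z) \<le> N (X y)"
    using continuous_attains_sup[OF is_norm_compact[OF M] _ cont] by auto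
  have "(SUP y\<in>{y. M y \<le> 1}. INF x\<in>S y. ereal (N x)) = (INF x\<in>S y. ereal (N x))"
    unfolding X(2) using y by (intro antisym SUP_least SUP_upper) auto
  then show ?thesis using y(1) \<open>J \<noteq> {}\<close> by (auto simp: hoffman_on_def S_def)
qed

lemma dual_min_attained:
  fixes A :: "real ^ 'n ^ 'm::finite"
  assumes N: "is_norm N" and M: "is_norm M" and "J \<noteq> {}"
  defines "V \<equiv> {v \<in> nonneg_orthant J. dual_norm M v = 1}"
  shows "\<exists>v\<in>V. (INF v\<in>V. ereal (dual_norm N (transpose (submatrix_rows A J) *v v))) =
                 ereal (dual_norm N (transpose (submatrix_rows A J) *v v))"
proof -
  let ?f = "\<lambda>v. dual_norm N (transpose (submatrix_rows A J) *v v)"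
  note D = is_norm_dual_norm[OF M]
  obtain j where "j \<in> J" using \<open>J \<noteq> {}\<close> by blast
  let ?e = "axis j 1 :: real^'m"
  have "?e \<noteq> 0" by (simp add: axis_eq_0_iff)
  then have "dual_norm M ?e \<noteq> 0" using D unfolding is_norm_def by blast
  then have e: "0 < dual_norm M ?e" using is_norm_nonneg[OF D, of ?e] by linarith
  have "dual_norm M ((1 / dual_norm M ?e) *\<^sub>R ?e) = 1"
    using D e unfolding is_norm_def by simp
  moreover have "(1 / dual_norm M ?e) *\<^sub>R ?e \<in> nonneg_orthant J"
    using \<open>j \<in> J\<close> e by (auto simp: nonneg_orthant_def coord_space_def axis_def)
  ultimately have ne: "V \<noteq> {}" unfolding V_def by blast
  have "V = {v. dual_norm M v \<le> 1} \<inter> ({v. dual_norm M v = 1} \<inter>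
        ((\<Inter>i\<in>-J. {v. v $ i = 0}) \<inter> (\<Inter>i\<in>J. {v. 0 \<le> v $ i})))"
    by (auto simp: V_def nonneg_orthant_def coord_space_def)
  moreover have "closed ({v. dual_norm M v = 1} \<inter>
        ((\<Inter>i\<in>-J. {v. v $ i = 0}) \<inter> (\<Inter>i\<in>J. {v. 0 \<le> v $ i})))"
    by (intro closed_Int closed_INT ballI closed_Collect_le closed_Collect_eq continuous_intros
        is_norm_continuous[OF D])
  ultimately have cp: "compact V" using is_norm_compact[OF D] by (simp add: compact_Int_closed)
  have "continuous_on UNIV ?f"
    by (rule continuous_on_compose2[OF is_norm_continuous[OF is_norm_dual_norm[OF N]]
          matrix_vector_mult_linear_continuous_on]) simp
  then have "continuous_on V ?f" by (rule continuous_on_subset) simp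
  then obtain v where v: "v \<in> V" "\<forall>w\<in>V. ?f v \<le> ?f w"
    using continuous_attains_inf[OF cp ne] by blast
  then have "(INF v\<in>V. ereal (?f v)) = ereal (?f v)"
    by (intro antisym INF_lower INF_greatest) auto
  with v(1) show ?thesis by blast
qed

end

theory Submission
  imports Defs
begin

text \<open>
  For a surjective set \<open>J\<close>, the identity between \<open>H\<^sub>J(A)\<close> and the reciprocal of the dual minimum is
  strong duality for \<open>min {\<parallel>x\<parallel> | A\<^sub>J x \<le> y\<^sub>J}\<close>. One inequality is weak duality: a multiplier \<open>v\<close> is
  paired with the \<open>y\<close> of norm one that attains \<open>\<langle>v, -y\<rangle> = \<parallel>v\<parallel>\<^sup>*\<close>. For the other, if the compact
  convex image under \<open>A\<^sub>J\<close> of the ball of radius \<open>1 / c\<close> missed the closed convex set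
  \<open>{z | z\<^sub>J \<le> y\<^sub>J}\<close>, a strictly separating functional would be a nonnegative multiplier \<open>a\<close> supported
  on \<open>J\<close> with \<open>\<parallel>A\<^sub>J\<^sup>T a\<parallel>\<^sup>* < c \<parallel>a\<parallel>\<^sup>*\<close>. Both parts then follow because \<open>H\<^sub>J(A)\<close> is monotone in \<open>J\<close>
  and subsets of surjective sets are surjective.
\<close>

section \<open>Arbitrary norms and their duals\<close>

lemma is_norm_norm: "is_norm (norm :: 'a::real_normed_vector \<Rightarrow> real)"
  by (simp add: is_norm_def norm_triangle_ineq)

lemma is_norm_minus: "is_norm N \<Longrightarrow> N (- x) = N x"
  unfolding is_norm_def by (metis abs_minus_cancel abs_one mult_1 scaleR_minus1_left)

lemma is_norm_scaleR: "is_norm N \<Longrightarrow> N (c *\<^sub>R x) = \<bar>c\<bar> * N x"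
  unfolding is_norm_def by blast

lemma is_norm_pos: "is_norm N \<Longrightarrow> x \<noteq> 0 \<Longrightarrow> 0 < N x"
  using is_norm_nonneg unfolding is_norm_def by (metis order_less_le)

text \<open>The generalized Cauchy-Schwarz inequality, obtained by scaling \<open>x\<close> to norm
  one. It supplies the last step of weak duality.\<close>

lemma inner_le_dual_norm:
  fixes N :: "'a::euclidean_space \<Rightarrow> real"
  assumes N: "is_norm N"
  shows "u \<bullet> x \<le> dual_norm N u * N x"
proof (cases "x = 0")
  case True
  then show ?thesis using is_norm_zero[OF N] by simp
next
  case False
  then have pos: "0 < N x" by (rule is_norm_pos[OF N])
  then have "N ((1 / N x) *\<^sub>R x) \<le> 1" by (simp add: is_norm_scaleR[OF N])
  from dual_norm_upper[OF N this, of u] show ?thesis using pos by (simp add: field_simps)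
qed

section \<open>Row submatrices and surjective sets\<close>

lemma submatrix_rows_mult:
  "(submatrix_rows A J *v x) $ i = (if i \<in> J then (A *v x) $ i else 0)"
  by (simp add: submatrix_rows_def matrix_vector_mult_def)

lemma submatrix_rows_UNIV: "submatrix_rows A UNIV = A"
  by (simp add: submatrix_rows_def vec_eq_iff)

lemma nonneg_orthant_empty: "nonneg_orthant {} = {0}"
  by (auto simp: nonneg_orthant_def coord_space_def vec_eq_iff)

text \<open>A multiplier vanishes outside \<open>J\<close>, so the sum only sees coordinates where
  \<open>y\<close> and \<open>z\<close> are compared.\<close>

lemma nonneg_orthant_inner_mono:
  assumes v: "v \<in> nonneg_orthant J" and le: "\<And>i. i \<in> J \<Longrightarrow> y $ i \<le> z $ i"
  shows "v \<bullet> y \<le> v \<bullet> z"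
proof -
  have "v $ i * y $ i \<le> v $ i * z $ i" for i
    using v le by (cases "i \<in> J") (auto simp: nonneg_orthant_def coord_space_def intro: mult_left_mono)
  then show ?thesis by (simp add: inner_vec_def sum_mono)
qed

text \<open>The summand from the orthant is the slack of the inequality system. In this form,
  closure under subsets is immediate.\<close>

lemma surjective_sets_iff:
  fixes A :: "real ^ 'n ^ 'm::finite"
  shows "J \<in> surjective_sets A \<longleftrightarrow> (\<forall>y. \<exists>x. \<forall>i\<in>J. (A *v x) $ i \<le> y $ i)"
proof
  assume "J \<in> surjective_sets A"
  \<comment> \<open>Only feasibility of the minimizer matters here; the Euclidean norm serves as an
    arbitrary choice.\<close>
  from hoffman_on_inner_min_attained[OF is_norm_norm this]
  show "\<forall>y. \<exists>x. \<forall>i\<in>J. (A *v x) $ i \<le> y $ i"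
    by (fastforce simp: submatrix_rows_mult)
next
  assume feas: "\<forall>y. \<exists>x. \<forall>i\<in>J. (A *v x) $ i \<le> y $ i"
  let ?B = "submatrix_rows A J"
  have "range ((*v) ?B) + nonneg_orthant J \<subseteq> coord_space J"
    by (auto simp: set_plus_def coord_space_def nonneg_orthant_def submatrix_rows_mult)
  moreover have "v \<in> range ((*v) ?B) + nonneg_orthant J" if v: "v \<in> coord_space J" for v
  proof -
    obtain x where "\<forall>i\<in>J. (A *v x) $ i \<le> v $ i" using feas by blast
    then have "v - ?B *v x \<in> nonneg_orthant J"
      using v by (auto simp: nonneg_orthant_def coord_space_def submatrix_rows_mult)
    then have "?B *v x + (v - ?B *v x) \<in> range ((*v) ?B) + nonneg_orthant J"
      by (intro set_plus_intro) auto
    then show ?thesis by simp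
  qed
  ultimately show "J \<in> surjective_sets A" unfolding surjective_sets_def by blast
qed

lemma surjective_sets_mono: "J \<in> surjective_sets A \<Longrightarrow> I \<subseteq> J \<Longrightarrow> I \<in> surjective_sets A"
  unfolding surjective_sets_iff by blast

lemma empty_in_surjective_sets: "{} \<in> surjective_sets A"
  by (simp add: surjective_sets_iff)

lemma UNIV_in_surjective_sets_iff:
  "UNIV \<in> surjective_sets A \<longleftrightarrow> range ((*v) A) + nonneg_orthant UNIV = UNIV"
  by (simp add: surjective_sets_def submatrix_rows_UNIV coord_space_def)

section \<open>Monotonicity of \<open>hoffman_on\<close> in the index set\<close>

lemma hoffman_on_nonneg:
  assumes N: "is_norm N" and M: "is_norm M"
  shows "0 \<le> hoffman_on N M A J"
proof (cases "J = {}")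
  case False
  have "M 0 \<le> 1" using is_norm_zero[OF M] by simp
  then show ?thesis
    using False is_norm_nonneg[OF N]
    by (auto simp: hoffman_on_def zero_ereal_def intro!: SUP_upper2[of 0] INF_greatest)
qed (simp add: hoffman_on_def)

text \<open>Additional rows shrink the feasible set and so raise the infimum for each
  \<open>y\<close>. The empty set has its value by convention and needs nonnegativity
  instead.\<close>

lemma hoffman_on_mono:
  assumes N: "is_norm N" and M: "is_norm M" and "I \<subseteq> J"
  shows "hoffman_on N M A I \<le> hoffman_on N M A J"
proof (cases "I = {}")
  case True
  then show ?thesis using hoffman_on_nonneg[OF N M] by (simp add: hoffman_on_def)
next
  case False
  with \<open>I \<subseteq> J\<close> show ?thesis
    by (auto simp: hoffman_on_def submatrix_rows_mult intro!: SUP_mono' INF_superset_mono)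
qed

section \<open>Strong duality for a surjective set\<close>

text \<open>The easy half of a theorem of alternatives: solving the system with right-hand side
  \<open>- v\<close> would give \<open>0 \<le> - (v \<bullet> v)\<close>. This makes the dual
  minimum positive and its reciprocal finite.\<close>

lemma nonneg_multiplier_nonzero:
  fixes A :: "real ^ 'n ^ 'm::finite"
  assumes J: "J \<in> surjective_sets A" and v: "v \<in> nonneg_orthant J" "v \<noteq> 0"
  shows "transpose (submatrix_rows A J) *v v \<noteq> 0"
proof
  let ?B = "submatrix_rows A J"
  assume "transpose ?B *v v = 0"
  moreover obtain x where x: "\<forall>i\<in>J. (A *v x) $ i \<le> (- v) $ i"
    using J unfolding surjective_sets_iff by blast
  ultimately have "v \<bullet> (?B *v x) = 0" by (simp add: dot_lmul_matrix[symmetric])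
  moreover have "v \<bullet> (?B *v x) \<le> v \<bullet> (- v)"
    using x v(1) by (intro nonneg_orthant_inner_mono[where J = J]) (simp_all add: submatrix_rows_mult)
  ultimately have "v \<bullet> v \<le> 0" by simp
  then show False using v(2) by (metis inner_gt_zero_iff not_le)
qed

lemma hoffman_on_eq:
  fixes A :: "real ^ 'n ^ 'm::finite"
  assumes N: "is_norm N" and M: "is_norm M" and J: "J \<in> surjective_sets A"
  shows "hoffman_on N M A J =
    1 / (INF v\<in>{v \<in> nonneg_orthant J. dual_norm M v = 1}.
           ereal (dual_norm N (transpose (submatrix_rows A J) *v v)))"
proof (cases "J = {}")
  case True
  have "dual_norm M 0 = 0" by (rule is_norm_zero[OF is_norm_dual_norm[OF M]])
  \<comment> \<open>Only \<open>0\<close> is supported on the empty set, so the infimum is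
    \<open>\<infinity>\<close> and its reciprocal is the conventional \<open>0\<close>.\<close>
  then have no_multiplier: "{v \<in> nonneg_orthant J. dual_norm M v = 1} = {}"
    by (auto simp: True nonneg_orthant_empty)
  show ?thesis unfolding no_multiplier using True by (simp add: hoffman_on_def top_ereal_def)
next
  case False
  let ?B = "submatrix_rows A J"
  let ?V = "{v \<in> nonneg_orthant J. dual_norm M v = 1}"
  let ?f = "\<lambda>v. dual_norm N (transpose ?B *v v)"
  note DM = is_norm_dual_norm[OF M] and DN = is_norm_dual_norm[OF N]
  have adj: "(transpose ?B *v v) \<bullet> x = v \<bullet> (?B *v x)" for v x
    by (simp add: dot_lmul_matrix[symmetric])
  obtain w where w: "w \<in> ?V" "(INF v\<in>?V. ereal (?f v)) = ereal (?f w)"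
    using dual_min_attained[OF N M False] by blast
  define c where "c = ?f w"
  have "w \<noteq> 0" using w(1) is_norm_zero[OF DM] by auto
  then have "transpose ?B *v w \<noteq> 0" using nonneg_multiplier_nonzero[OF J] w(1) by blast
  then have c: "0 < c" unfolding c_def by (rule is_norm_pos[OF DN])
  have min: "c \<le> ?f v" if "v \<in> ?V" for v
  proof -
    have "(INF v\<in>?V. ereal (?f v)) \<le> ereal (?f v)" using that by (rule INF_lower)
    then show ?thesis using w(2) by (simp add: c_def)
  qed
  \<comment> \<open>Homogeneity removes the normalization, since the separating functional below
    need not have dual norm one.\<close>
  have min_hom: "c * dual_norm M v \<le> ?f v" if v: "v \<in> nonneg_orthant J" for v
  proof (cases "v = 0")
    case True
    then show ?thesis using is_norm_zero[OF DM] is_norm_zero[OF DN] by simp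
  next
    case False
    then have pos: "0 < dual_norm M v" by (rule is_norm_pos[OF DM])
    let ?v = "(1 / dual_norm M v) *\<^sub>R v"
    have "dual_norm M ?v = 1" using pos by (simp add: is_norm_scaleR[OF DM])
    moreover have "?v \<in> nonneg_orthant J"
      using v pos by (auto simp: nonneg_orthant_def coord_space_def)
    ultimately have "c \<le> ?f ?v" using min by blast
    also have "\<dots> = ?f v / dual_norm M v"
      using pos by (simp add: matrix_vector_mult_scaleR is_norm_scaleR[OF DN])
    finally show ?thesis using pos by (simp add: field_simps)
  qed
  have feasible: "\<exists>x. (\<forall>i\<in>J. (?B *v x) $ i \<le> y $ i) \<and> N x \<le> 1 / c" if y: "M y \<le> 1" for y
  proof (rule ccontr)
    assume none: "\<not> ?thesis"
    let ?K = "(*v) ?B ` {x. N x \<le> 1 / c}"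
    let ?Y = "{z. \<forall>i\<in>J. z $ i \<le> y $ i}"
    have Y_eq: "?Y = (\<Inter>i\<in>J. {z. z $ i \<le> y $ i})" by auto
    have "convex {x. N x \<le> 1 / c}"
      by (auto simp: convex_def intro: order_trans[OF convex_lower[OF is_norm_convex[OF N]]])
    then have "convex ?K" by (intro convex_linear_image matrix_vector_mul_linear)
    moreover have "compact ?K"
      by (intro compact_continuous_image is_norm_compact[OF N]
          matrix_vector_mult_linear_continuous_on)
    moreover have "?K \<noteq> {}" using is_norm_zero[OF N] c by (auto intro!: exI[of _ 0])
    moreover have "convex ?Y"
      by (auto simp: convex_def intro!: convex_bound_le)
    moreover have "closed ?Y"
      unfolding Y_eq by (intro closed_INT ballI closed_Collect_le continuous_intros)
    moreover have "?K \<inter> ?Y = {}" using none by auto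
    ultimately obtain a b where sep: "\<forall>k\<in>?K. a \<bullet> k < b" "\<forall>z\<in>?Y. a \<bullet> z > b"
      using separating_hyperplane_compact_closed[of ?K ?Y] by blast
    have y_gt: "a \<bullet> y > b" using sep(2) by auto
    \<comment> \<open>Moving \<open>y\<close> along axis \<open>i\<close> stays in \<open>?Y\<close>
      for \<open>t \<le> 0\<close>, and for every \<open>t\<close> if \<open>i\<close> is outside
      \<open>J\<close>.\<close>
    have shift_gt: "a \<bullet> y + t * a $ i > b" if t: "i \<in> J \<longrightarrow> t \<le> 0" for i t
    proof -
      have "y + t *\<^sub>R axis i 1 \<in> ?Y" using t by (auto simp: axis_def)
      then have "a \<bullet> (y + t *\<^sub>R axis i 1) > b" using sep(2) by blast
      then show ?thesis by (simp add: inner_add_right inner_axis)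
    qed
    \<comment> \<open>This shift would land exactly on the separating hyperplane, so it must not be
      admissible; that fixes the sign and support of \<open>a\<close>.\<close>
    have hits_b: "a \<bullet> y + ((b - a \<bullet> y) / a $ i) * a $ i = b" if "a $ i \<noteq> 0" for i
      using that by simp
    have a_sign: "a $ i \<le> 0" if "i \<in> J" for i
    proof (rule ccontr)
      assume pos: "\<not> a $ i \<le> 0"
      then have "(b - a \<bullet> y) / a $ i \<le> 0" using y_gt by (simp add: divide_nonpos_pos)
      then have "a \<bullet> y + ((b - a \<bullet> y) / a $ i) * a $ i > b" by (intro shift_gt) simp
      then show False using hits_b[of i] pos by linarith
    qed
    have a_supp: "a $ i = 0" if "i \<notin> J" for i
    proof (rule ccontr)
      assume "a $ i \<noteq> 0"
      moreover have "a \<bullet> y + ((b - a \<bullet> y) / a $ i) * a $ i > b"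
        using that by (intro shift_gt) simp
      ultimately show False using hits_b[of i] by linarith
    qed
    have orth: "- a \<in> nonneg_orthant J"
      using a_sign a_supp by (auto simp: nonneg_orthant_def coord_space_def)
    \<comment> \<open>Scaled by \<open>- 1 / c\<close>, this maximizer lies in the ball defining
      \<open>?K\<close>, and \<open>a\<close> takes the value \<open>?f (- a) / c\<close> at its
      image.\<close>
    obtain x where x: "N x \<le> 1" "?f (- a) = (transpose ?B *v (- a)) \<bullet> x"
      using dual_norm_attained[OF N] by blast
    have "N ((- 1 / c) *\<^sub>R x) \<le> 1 / c"
      using x(1) c by (simp add: is_norm_minus[OF N] is_norm_scaleR[OF N] divide_right_mono)
    then have "a \<bullet> (?B *v ((- 1 / c) *\<^sub>R x)) < b" using sep(1) by blast
    then have "?f (- a) / c < b"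
      unfolding x(2) adj by (simp add: linear_neg[OF matrix_vector_mul_linear] matrix_vector_mult_scaleR)
    also have "b < (- a) \<bullet> (- y)" using y_gt by simp
    also have "\<dots> \<le> dual_norm M (- a)"
      using y by (intro dual_norm_upper[OF M]) (simp add: is_norm_minus[OF M])
    finally have "?f (- a) < c * dual_norm M (- a)" using c by (simp add: field_simps)
    with min_hom[OF orth] show False by simp
  qed
  have "(INF x\<in>{x. \<forall>i\<in>J. (?B *v x) $ i \<le> y $ i}. ereal (N x)) \<le> ereal (1 / c)"
    if y: "M y \<le> 1" for y
  proof -
    obtain x where "\<forall>i\<in>J. (?B *v x) $ i \<le> y $ i" "N x \<le> 1 / c"
      using feasible[OF y] by blast
    then show ?thesis by (intro INF_lower2[of x]) auto
  qed
  then have upper: "hoffman_on N M A J \<le> ereal (1 / c)"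
    using False unfolding hoffman_on_def by (auto intro: SUP_least)
  \<comment> \<open>Weak duality: with right-hand side \<open>- y\<close>, the optimal multiplier
    \<open>w\<close> forces every feasible \<open>x\<close> to have norm at least
    \<open>1 / c\<close>.\<close>
  obtain y where y: "M y \<le> 1" "dual_norm M w = w \<bullet> y"
    using dual_norm_attained[OF M] by blast
  have "ereal (1 / c) \<le> (INF x\<in>{x. \<forall>i\<in>J. (?B *v x) $ i \<le> (- y) $ i}. ereal (N x))"
  proof (rule INF_greatest)
    fix x assume "x \<in> {x. \<forall>i\<in>J. (?B *v x) $ i \<le> (- y) $ i}"
    then have "w \<bullet> (?B *v x) \<le> w \<bullet> (- y)"
      using w(1) by (intro nonneg_orthant_inner_mono[where J = J]) simp_all
    also have "\<dots> = - 1" using y(2) w(1) by simp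
    finally have "1 \<le> (transpose ?B *v w) \<bullet> (- x)"
      unfolding adj by (simp add: linear_neg[OF matrix_vector_mul_linear])
    also have "\<dots> \<le> c * N x"
      using inner_le_dual_norm[OF N, of "transpose ?B *v w" "- x"]
      by (simp add: c_def is_norm_minus[OF N])
    finally show "ereal (1 / c) \<le> ereal (N x)" using c by (simp add: field_simps)
  qed
  also have "\<dots> \<le> hoffman_on N M A J"
    using False y(1) unfolding hoffman_on_def
    by (simp only: if_False) (rule SUP_upper, simp add: is_norm_minus[OF M])
  finally have "hoffman_on N M A J = ereal (1 / c)" using upper by simp
  then show ?thesis using w(2) c by (simp add: c_def one_ereal_def)
qed

section \<open>Reduction to a covering family\<close>

text \<open>By monotonicity each surjective set is dominated by a member of \<open>\<F>\<close>
  containing it. Part (a) uses the family \<open>{UNIV}\<close>, part (b) the given one.\<close>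

lemma hoffman_eq_Max:
  fixes A :: "real ^ 'n ^ 'm::finite"
  assumes N: "is_norm N" and M: "is_norm M"
    and sub: "\<F> \<subseteq> surjective_sets A"
    and cover: "\<And>J. J \<in> surjective_sets A \<Longrightarrow> \<exists>F\<in>\<F>. J \<subseteq> F"
  shows "hoffman N M A = Max (hoffman_on N M A ` \<F>)"
proof -
  let ?h = "hoffman_on N M A"
  \<comment> \<open>The empty index set must also be covered, so \<open>Max\<close> is taken over a
    nonempty set.\<close>
  have ne: "\<F> \<noteq> {}" using cover[OF empty_in_surjective_sets] by blast
  have "?h J \<le> Max (?h ` \<F>)" if J: "J \<in> surjective_sets A" for J
  proof -
    obtain F where F: "F \<in> \<F>" "J \<subseteq> F" using cover[OF J] by blast
    have "?h J \<le> ?h F" by (rule hoffman_on_mono[OF N M F(2)])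
    also have "\<dots> \<le> Max (?h ` \<F>)" using F(1) by simp
    finally show ?thesis .
  qed
  then have "Max (?h ` surjective_sets A) \<le> Max (?h ` \<F>)"
    using empty_in_surjective_sets by (subst Max_le_iff) auto
  moreover have "Max (?h ` \<F>) \<le> Max (?h ` surjective_sets A)"
    using ne sub by (intro Max_mono) auto
  ultimately show ?thesis unfolding hoffman_def by simp
qed

theorem corollary1:
  fixes A :: "real ^ 'n ^ 'm"
    and N :: "real ^ 'n \<Rightarrow> real" and M :: "real ^ 'm \<Rightarrow> real"
  assumes "is_norm N" and "is_norm M"
  shows
    "(range ((*v) A) + nonneg_orthant UNIV = UNIV \<longrightarrow>
        hoffman N M A =
          1 / (INF v\<in>{v \<in> nonneg_orthant UNIV. dual_norm M v = 1}.
                 ereal (dual_norm N (transpose A *v v)))) \<and>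
     (\<forall>\<F> \<I>.
        \<F> \<subseteq> surjective_sets A \<longrightarrow>
        \<I> \<subseteq> UNIV - surjective_sets A \<longrightarrow>
        (\<forall>J. (\<exists>F\<in>\<F>. J \<subseteq> F) \<or> (\<exists>I\<in>\<I>. I \<subseteq> J)) \<longrightarrow>
        hoffman N M A = Max (hoffman_on N M A ` \<F>) \<and>
        Max (hoffman_on N M A ` \<F>) =
          Max ((\<lambda>J. 1 / (INF v\<in>{v \<in> nonneg_orthant J. dual_norm M v = 1}.
                           ereal (dual_norm N (transpose (submatrix_rows A J) *v v)))) ` \<F>))"
proof (intro conjI impI allI)
  assume "range ((*v) A) + nonneg_orthant UNIV = UNIV"
  then have S: "UNIV \<in> surjective_sets A" by (simp add: UNIV_in_surjective_sets_iff)
  have "hoffman N M A = Max (hoffman_on N M A ` {UNIV})"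
    using S by (intro hoffman_eq_Max assms) auto
  then show "hoffman N M A = 1 / (INF v\<in>{v \<in> nonneg_orthant UNIV. dual_norm M v = 1}.
      ereal (dual_norm N (transpose A *v v)))"
    by (simp add: hoffman_on_eq[OF assms S] submatrix_rows_UNIV)
next
  fix \<F> \<I>
  assume F: "\<F> \<subseteq> surjective_sets A" and I: "\<I> \<subseteq> UNIV - surjective_sets A"
    and cover: "\<forall>J. (\<exists>F\<in>\<F>. J \<subseteq> F) \<or> (\<exists>I\<in>\<I>. I \<subseteq> J)"
  show "hoffman N M A = Max (hoffman_on N M A ` \<F>)"
  proof (rule hoffman_eq_Max[OF assms F])
    fix J assume "J \<in> surjective_sets A"
    \<comment> \<open>A subset of a surjective set is surjective, which rules out the second
      alternative of \<open>cover\<close>.\<close>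
    then have "I \<notin> \<I>" if "I \<subseteq> J" for I
      using surjective_sets_mono that I by blast
    then show "\<exists>F\<in>\<F>. J \<subseteq> F" using cover by blast
  qed
  show "Max (hoffman_on N M A ` \<F>) =
      Max ((\<lambda>J. 1 / (INF v\<in>{v \<in> nonneg_orthant J. dual_norm M v = 1}.
        ereal (dual_norm N (transpose (submatrix_rows A J) *v v)))) ` \<F>)"
    using F hoffman_on_eq[OF assms] by (intro arg_cong[where f = Max] image_cong) auto
qed

end
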